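(* Let $G$ be a finite group with hypercenter $Z_\infty(G)$. (a) The Engel digraph of $G$ is isomorphic to the lexicographic product of a complete directed graph of order $|Z_\infty(G)|$ by the Engel digraph of $G/Z_\infty(G)$. (b) The Engel graph of $G$ is isomorphic to the lexicographic product of a complete graph of order $|Z_\infty(G)|$ by the Engel graph of $G/Z_\infty(G)$. (c) The co-Engel graph of $G$ is isomorphic to the lexicographic product of a null graph of order $|Z_\infty(G)|$ by the co-Engel graph of $G/Z_\infty(G)$.
   Context: For elements $x,y$ of a group, $[x,y]=x^{-1}y^{-1}xy$, $[x,{}_1y]=[x,y]$ and $[x,{}_{k+1}y]=[[x,{}_ky],y]$ for $k\ge 1$. For a finite group $G$: the Engel digraph of $G$ has vertex set $G$ and, for distinct $x,y$, an arc $x\to y$ if there exists $k\geq 1$ such that $[y,{}_kx]=1$; the Engel graph is the undirected graph on $G$ obtained by ignoring directions (distinct $x,y$ are adjacent iff there is $k\ge1$ with $[x,{}_ky]=1$ or $[y,{}_kx]=1$); the co-Engel graph is the complement of the Engel graph, with vertex set all of $G$. The hypercenter is $Z_\infty(G)=\bigcup_{k\ge 1}Z_k(G)$, where $Z_1(G)=Z(G)$ and $Z_{k+1}(G)/Z_k(G)=Z(G/Z_k(G))$. The lexicographic product of $\Gamma_1$ by $\Gamma_2$ (graphs, or digraphs) has vertex set $V(\Gamma_1)\times V(\Gamma_2)$, regarded as a disjoint union of copies $C_x$ of $V(\Gamma_1)$ indexed by $x\in V(\Gamma_2)$; a copy of $\Gamma_1$ is placed on each $C_x$, and for $x\neq y$,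 if there is an edge (resp. arc) from $x$ to $y$ in $\Gamma_2$ then all edges (resp. arcs) from $C_x$ to $C_y$ are included, and otherwise none. A complete directed graph has arcs in both directions between every two distinct vertices; a null graph has no edges. *)

theory Defs
  imports "HOL-Algebra.Coset" "Graph_Theory.Graph_Theory"
begin

section \<open>Commutators and the hypercenter\<close>

definition comm :: "('a, 'b) monoid_scheme \<Rightarrow> 'a \<Rightarrow> 'a \<Rightarrow> 'a" where
  "comm G x y = inv\<^bsub>G\<^esub> x \<otimes>\<^bsub>G\<^esub> inv\<^bsub>G\<^esub> y \<otimes>\<^bsub>G\<^esub> x \<otimes>\<^bsub>G\<^esub> y"

text \<open>\<open>iter_comm G x k y\<close> is \<open>[x, _k y]\<close>, extended by \<open>[x, _0 y] = x\<close>.\<close>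

primrec iter_comm :: "('a, 'b) monoid_scheme \<Rightarrow> 'a \<Rightarrow> nat \<Rightarrow> 'a \<Rightarrow> 'a" where
  "iter_comm G x 0 y = x"
| "iter_comm G x (Suc k) y = comm G (iter_comm G x k y) y"

definition center :: "('a, 'b) monoid_scheme \<Rightarrow> 'a set" where
  "center G = {z \<in> carrier G. \<forall>g \<in> carrier G. z \<otimes>\<^bsub>G\<^esub> g = g \<otimes>\<^bsub>G\<^esub> z}"

text \<open>The term of index \<open>k + 1\<close> is the preimage in \<open>G\<close> of the center of the quotient by the term
  of index \<open>k\<close>.\<close>

fun upper_central :: "('a, 'b) monoid_scheme \<Rightarrow> nat \<Rightarrow> 'a set" where
  "upper_central G 0 = {\<one>\<^bsub>G\<^esub>}"
| "upper_central G (Suc 0) = center G"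
| "upper_central G (Suc (Suc k)) =
    {x \<in> carrier G. upper_central G (Suc k) #>\<^bsub>G\<^esub> x \<in> center (G Mod upper_central G (Suc k))}"

lemma upper_central_Suc_quotient:
  assumes "k \<ge> 1"
  shows "(\<lambda>x. upper_central G k #>\<^bsub>G\<^esub> x) ` upper_central G (Suc k)
    = center (G Mod upper_central G k)"
proof -
  obtain m where k: "k = Suc m"
    using assms by (cases k) auto
  have "center (G Mod upper_central G k) \<subseteq> (\<lambda>x. upper_central G k #>\<^bsub>G\<^esub> x) ` carrier G"
    by (auto simp: center_def carrier_FactGroup)
  then show ?thesis
    unfolding k by auto
qed

definition hypercenter :: "('a, 'b) monoid_scheme \<Rightarrow> 'a set" where
  "hypercenter G = (\<Union>k \<in> {1..}. upper_central G k)"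

section \<open>Engel graphs\<close>

text \<open>Undirected graphs are represented, as in the library, by symmetric digraphs.\<close>

definition engel_digraph :: "('a, 'b) monoid_scheme \<Rightarrow> 'a pair_pre_digraph" where
  "engel_digraph G = \<lparr> pverts = carrier G,
    parcs = {(x, y). x \<in> carrier G \<and> y \<in> carrier G \<and> x \<noteq> y \<and>
      (\<exists>k \<ge> 1. iter_comm G y k x = \<one>\<^bsub>G\<^esub>)} \<rparr>"

definition engel_graph :: "('a, 'b) monoid_scheme \<Rightarrow> 'a pair_pre_digraph" where
  "engel_graph G = mk_symmetric (with_proj (engel_digraph G))"

lemma pverts_engel_graph: "pverts (engel_graph G) = carrier G"
  by (simp add: engel_graph_def engel_digraph_def)

lemma parcs_engel_graph:
  "(x, y) \<in> parcs (engel_graph G) \<longleftrightarrow> x \<in> carrier G \<and> y \<in> carrier G \<and> x \<noteq> y \<and>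
    (\<exists>k \<ge> 1. iter_comm G x k y = \<one>\<^bsub>G\<^esub> \<or> iter_comm G y k x = \<one>\<^bsub>G\<^esub>)"
  by (auto simp: engel_graph_def engel_digraph_def parcs_mk_symmetric)

definition complement_graph :: "'a pair_pre_digraph \<Rightarrow> 'a pair_pre_digraph" where
  "complement_graph D = \<lparr> pverts = pverts D,
    parcs = {(x, y). x \<in> pverts D \<and> y \<in> pverts D \<and> x \<noteq> y \<and> (x, y) \<notin> parcs D} \<rparr>"

definition coengel_graph :: "('a, 'b) monoid_scheme \<Rightarrow> 'a pair_pre_digraph" where
  "coengel_graph G = complement_graph (engel_graph G)"

section \<open>Lexicographic products and null graphs\<close>

text \<open>The first factor is the one placed on each copy: the copy indexed by \<open>x\<close> is
  \<open>pverts D1 \<times> {x}\<close>.\<close>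

definition lex_product ::
  "'a pair_pre_digraph \<Rightarrow> 'b pair_pre_digraph \<Rightarrow> ('a \<times> 'b) pair_pre_digraph" where
  "lex_product D1 D2 = \<lparr> pverts = pverts D1 \<times> pverts D2,
    parcs = {((a, x), (b, y)). a \<in> pverts D1 \<and> b \<in> pverts D1 \<and> x \<in> pverts D2 \<and> y \<in> pverts D2 \<and>
      (if x = y then (a, b) \<in> parcs D1 else (x, y) \<in> parcs D2)} \<rparr>"

text \<open>Companion of the library's \<^const>\<open>complete_digraph\<close>.\<close>

definition null_digraph :: "nat \<Rightarrow> ('a, 'b) pre_digraph \<Rightarrow> bool" where
  "null_digraph n D \<longleftrightarrow> graph D \<and> card (verts D) = n \<and> arcs_ends D = {}"

end

theory Submission
  imports Defs
begin

text \<open>Every term of the upper central series consists of the elements all of whose commutators lie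
  in the preceding term. An element of the hypercenter \<open>Z\<close> is therefore killed by finitely many
  commutations with any fixed element, so that \<open>[x, _k y] \<in> Z\<close> implies \<open>[x, _m y] = \<one>\<close> for some
  larger \<open>m\<close>: the Engel relation between \<open>x\<close> and \<open>y\<close> depends only on their cosets modulo \<open>Z\<close>, and it
  always holds inside a coset. Numbering the elements of each coset by the vertices of the first
  factor gives the isomorphisms.\<close>

section \<open>The upper central series\<close>

context group
begin

lemma comm_closed [simp]: "x \<in> carrier G \<Longrightarrow> y \<in> carrier G \<Longrightarrow> comm G x y \<in> carrier G"
  by (simp add: comm_def)

lemma iter_comm_closed [simp]:
  "x \<in> carrier G \<Longrightarrow> y \<in> carrier G \<Longrightarrow> iter_comm G x k y \<in> carrier G"
  by (induction k) auto

lemma comm_eq_one_iff: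
  assumes "x \<in> carrier G" "y \<in> carrier G"
  shows "comm G x y = \<one> \<longleftrightarrow> x \<otimes> y = y \<otimes> x"
proof -
  have "comm G x y = inv (y \<otimes> x) \<otimes> (x \<otimes> y)"
    using assms by (simp add: comm_def inv_mult_group m_assoc)
  then show ?thesis
    using assms inv_equality[of "inv (y \<otimes> x)" "x \<otimes> y"] by (metis inv_inv inv_closed l_inv m_closed)
qed

text \<open>The recursion peels off the last commutation. This lets the first one be split off, or
  further ones be appended.\<close>

lemma iter_comm_add: "iter_comm G x (k + m) y = iter_comm G (iter_comm G x k y) m y"
  by (induction m) auto

lemma iter_comm_self:
  assumes "x \<in> carrier G" "k \<ge> 1"
  shows "iter_comm G x k x = \<one>"
  using assms(2)
proof (induction k rule: dec_induct)
  case base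
  then show ?case using assms(1) by (simp add: comm_eq_one_iff)
next
  case (step k)
  then show ?case using assms(1) by (simp add: comm_eq_one_iff)
qed

end

section \<open>Commutators under homomorphisms and modulo a normal subgroup\<close>

lemma (in group_hom) hom_comm:
  assumes "x \<in> carrier G" "y \<in> carrier G"
  shows "h (comm G x y) = comm H (h x) (h y)"
  using assms by (simp add: comm_def)

lemma (in group_hom) hom_iter_comm:
  assumes "x \<in> carrier G" "y \<in> carrier G"
  shows "h (iter_comm G x k y) = iter_comm H (h x) k (h y)"
  using assms by (induction k) (simp_all add: hom_comm)

context normal
begin

lemma group_hom_FactGroup: "group_hom G (G Mod H) (\<lambda>x. H #> x)"
  using r_coset_hom_Mod factorgroup_is_group is_group
  by (simp add: group_hom_def group_hom_axioms_def)

lemma rcos_eq_self_iff: "x \<in> carrier G \<Longrightarrow> H #> x = H \<longleftrightarrow> x \<in> H"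
  using coset_join1 coset_join2 subgroup_axioms by blast

text \<open>The projection preserves commutators and sends exactly \<open>H\<close> to the identity,
  so \<open>comm_eq_one_iff\<close> in the quotient decides membership.\<close>

lemma comm_mem_iff:
  assumes "x \<in> carrier G" "y \<in> carrier G"
  shows "comm G x y \<in> H \<longleftrightarrow>
    (H #> x) \<otimes>\<^bsub>G Mod H\<^esub> (H #> y) = (H #> y) \<otimes>\<^bsub>G Mod H\<^esub> (H #> x)"
proof -
  interpret h: group_hom G "G Mod H" "\<lambda>x. H #> x" by (rule group_hom_FactGroup)
  have "comm G x y \<in> H \<longleftrightarrow> comm (G Mod H) (H #> x) (H #> y) = \<one>\<^bsub>G Mod H\<^esub>"
    using assms rcos_eq_self_iff[of "comm G x y"] h.hom_comm[of x y] by simp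
  with assms show ?thesis
    using h.H.comm_eq_one_iff[of "H #> x" "H #> y"] h.hom_closed by blast
qed

lemma rcos_mem_center_iff:
  assumes "x \<in> carrier G"
  shows "H #> x \<in> center (G Mod H) \<longleftrightarrow> (\<forall>g \<in> carrier G. comm G x g \<in> H)"
proof -
  have "H #> x \<in> carrier (G Mod H)"
    using assms by (auto simp: carrier_FactGroup)
  then show ?thesis
    using assms comm_mem_iff by (auto simp: center_def carrier_FactGroup)
qed

text \<open>The commutator is the product of \<open>inv x\<close> and the conjugate
  \<open>inv g \<otimes> x \<otimes> g\<close>, both in \<open>H\<close>. This is what makes the
  upper central series increase.\<close>

lemma comm_mem:
  assumes "x \<in> H" "g \<in> carrier G"
  shows "comm G x g \<in> H"
proof -
  have "inv x \<otimes> (inv g \<otimes> x \<otimes> g) \<in> H"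
    using assms inv_op_closed1 by simp
  then show ?thesis
    using assms by (simp add: comm_def m_assoc)
qed

end

lemma (in group) normal_center: "center G \<lhd> G"
proof (subst normal_inv_iff, intro conjI ballI)
  show "subgroup (center G) G"
  proof (rule subgroupI)
    show "inv a \<in> center G" if "a \<in> center G" for a
      using that by (simp add: center_def) (metis inv_closed inv_inv inv_mult_group)
    show "a \<otimes> b \<in> center G" if "a \<in> center G" "b \<in> center G" for a b
    proof -
      have ab: "a \<in> carrier G" "b \<in> carrier G"
        using that by (simp_all add: center_def)
      have "a \<otimes> b \<otimes> g = g \<otimes> (a \<otimes> b)" if g: "g \<in> carrier G" for g
      proof -
        have *: "a \<otimes> g = g \<otimes> a" "b \<otimes> g = g \<otimes> b"
          using \<open>a \<in> center G\<close> \<open>b \<in> center G\<close> g unfolding center_def by blast+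
        have "a \<otimes> b \<otimes> g = a \<otimes> g \<otimes> b"
          using ab g by (simp only: m_assoc *(2))
        also have "\<dots> = g \<otimes> (a \<otimes> b)"
          using ab g by (simp only: m_assoc *(1))
        finally show ?thesis .
      qed
      with ab show ?thesis by (simp add: center_def)
    qed
  qed (auto simp: center_def)
  show "x \<otimes> z \<otimes> inv x \<in> center G" if "x \<in> carrier G" "z \<in> center G" for x z
  proof -
    have z: "z \<in> carrier G" "x \<otimes> z = z \<otimes> x"
      using that unfolding center_def by auto
    then have "x \<otimes> z \<otimes> inv x = z"
      using that(1) by (simp add: m_assoc)
    with that show ?thesis by simp
  qed
qed

text \<open>Applied to the projection and the center of the quotient, this is the inductive step for
  normality of the upper central series.\<close>

lemma (in group_hom) normal_vimage:
  assumes "N \<lhd> H"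
  shows "{x \<in> carrier G. h x \<in> N} \<lhd> G"
proof -
  interpret N: normal N H by fact
  show ?thesis
  proof (subst G.normal_inv_iff, intro conjI ballI)
    show "subgroup {x \<in> carrier G. h x \<in> N} G"
      by (rule G.subgroupI) auto
  qed (auto simp: N.inv_op_closed2)
qed

section \<open>The terms of the upper central series, the hypercenter and the Engel relation\<close>

context group
begin

lemma normal_upper_central: "upper_central G k \<lhd> G"
proof (induction k)
  case 0
  then show ?case by (simp add: one_is_normal)
next
  case (Suc k)
  then interpret N: normal "upper_central G k" G by simp
  interpret h: group_hom G "G Mod upper_central G k" "\<lambda>x. upper_central G k #> x"
    by (rule N.group_hom_FactGroup)
  show ?case
    using h.normal_vimage[OF h.H.normal_center] by (cases k) (simp_all add: normal_center)
qed

text \<open>This coset-free form treats both successor clauses of the definition alike: for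
  \<open>k = 0\<close> a trivial commutator means commuting, and for larger \<open>k\<close> the
  criterion for central cosets applies.\<close>

lemma mem_upper_central_Suc_iff:
  "x \<in> upper_central G (Suc k) \<longleftrightarrow>
    x \<in> carrier G \<and> (\<forall>g \<in> carrier G. comm G x g \<in> upper_central G k)"
proof (cases k)
  case 0
  then show ?thesis
    by (auto simp: center_def comm_eq_one_iff)
next
  case (Suc m)
  interpret N: normal "upper_central G k" G by (rule normal_upper_central)
  show ?thesis
    using N.rcos_mem_center_iff by (auto simp: Suc)
qed

lemma upper_central_mono: "m \<le> n \<Longrightarrow> upper_central G m \<subseteq> upper_central G n"
proof (rule lift_Suc_mono_le[where f = "upper_central G"])
  fix k
  interpret N: normal "upper_central G k" G by (rule normal_upper_central)
  show "upper_central G k \<subseteq> upper_central G (Suc k)"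
    using N.comm_mem N.subset unfolding mem_upper_central_Suc_iff subset_iff by blast
qed

text \<open>Each commutation with \<open>y\<close> lowers the index in the series by one, so
  \<open>k\<close> of them end in the trivial term of index 0.\<close>

lemma iter_comm_upper_central:
  "z \<in> upper_central G k \<Longrightarrow> y \<in> carrier G \<Longrightarrow> iter_comm G z k y = \<one>"
proof (induction k arbitrary: z)
  case (Suc k)
  then have "comm G z y \<in> upper_central G k"
    by (simp only: mem_upper_central_Suc_iff)
  with Suc have "iter_comm G (comm G z y) k y = \<one>" by blast
  \<comment> \<open>The induction treats the commutation applied first, so it is split off here with
    \<open>k = 1\<close> in \<open>iter_comm_add\<close>.\<close>
  then show ?case
    using iter_comm_add[of z 1 k y] by simp
qed simp

text \<open>Inverses and conjugates stay in the same term; for products, two elements lie in a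
  common term because the series increases.\<close>

lemma normal_hypercenter: "hypercenter G \<lhd> G"
proof (subst normal_inv_iff, intro conjI ballI)
  note N = normal_upper_central
  note subgroup = normal_imp_subgroup[OF N]
  show "subgroup (hypercenter G) G"
  proof (rule subgroupI)
    show "hypercenter G \<subseteq> carrier G"
      using subgroup.subset[OF subgroup] by (auto simp: hypercenter_def)
    have "\<one> \<in> hypercenter G"
      using subgroup.one_closed[OF subgroup] by (auto simp: hypercenter_def)
    then show "hypercenter G \<noteq> {}" by blast
    show "inv a \<in> hypercenter G" if "a \<in> hypercenter G" for a
      using that subgroup.m_inv_closed[OF subgroup] by (auto simp: hypercenter_def)
    show "a \<otimes> b \<in> hypercenter G" if "a \<in> hypercenter G" "b \<in> hypercenter G" for a b
    proof -
      from that obtain m n where "m \<ge> 1" "a \<in> upper_central G m" "b \<in> upper_central G n"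
        by (auto simp: hypercenter_def)
      moreover from this have "a \<otimes> b \<in> upper_central G (max m n)"
        using upper_central_mono[of m "max m n"] upper_central_mono[of n "max m n"]
        by (intro subgroup.m_closed[OF subgroup]) auto
      \<comment> \<open>The union defining the hypercenter starts at index 1, which is why
        \<open>m \<ge> 1\<close> was retained.\<close>
      moreover have "max m n \<in> {1..}"
        using \<open>m \<ge> 1\<close> by simp
      ultimately show ?thesis
        unfolding hypercenter_def by blast
    qed
  qed
  show "x \<otimes> z \<otimes> inv x \<in> hypercenter G" if "x \<in> carrier G" "z \<in> hypercenter G" for x z
    using that normal.inv_op_closed2[OF N] by (auto simp: hypercenter_def)
qed

text \<open>Being trivial in the quotient means that the iterated commutator lies in some term
  \<open>upper_central G m\<close>, where \<open>m\<close> further commutations with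
  \<open>y\<close> kill it.\<close>

lemma engel_iff_engel_Mod_hypercenter:
  assumes "x \<in> carrier G" "y \<in> carrier G"
  shows "(\<exists>k \<ge> 1. iter_comm (G Mod hypercenter G) (hypercenter G #> x) k (hypercenter G #> y)
      = \<one>\<^bsub>G Mod hypercenter G\<^esub>) \<longleftrightarrow> (\<exists>k \<ge> 1. iter_comm G x k y = \<one>)"
    (is "?L \<longleftrightarrow> ?R")
proof -
  interpret Z: normal "hypercenter G" G by (rule normal_hypercenter)
  interpret h: group_hom G "G Mod hypercenter G" "\<lambda>x. hypercenter G #> x"
    by (rule Z.group_hom_FactGroup)
  have "?L \<longleftrightarrow> (\<exists>k \<ge> 1. iter_comm G x k y \<in> hypercenter G)"
    using assms Z.rcos_eq_self_iff h.hom_iter_comm[OF assms, symmetric] by simp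
  also have "\<dots> \<longleftrightarrow> ?R"
  proof
    assume "\<exists>k \<ge> 1. iter_comm G x k y \<in> hypercenter G"
    then obtain k m where "k \<ge> 1" "iter_comm G x k y \<in> upper_central G m"
      by (auto simp: hypercenter_def)
    then have "iter_comm G x (k + m) y = \<one>" "k + m \<ge> 1"
      using assms(2) iter_comm_upper_central by (simp_all add: iter_comm_add)
    then show ?R by blast
  next
    assume ?R
    then show "\<exists>k \<ge> 1. iter_comm G x k y \<in> hypercenter G"
      using Z.one_closed by metis
  qed
  finally show ?thesis .
qed

text \<open>In the quotient both elements become one coset, which commutes with itself; the relation
  then lifts to \<open>G\<close>.\<close>

lemma engel_if_rcos_hypercenter_eq:
  assumes "x \<in> carrier G" "y \<in> carrier G" "hypercenter G #> x = hypercenter G #> y"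
  shows "\<exists>k \<ge> 1. iter_comm G x k y = \<one>"
proof -
  interpret Z: normal "hypercenter G" G by (rule normal_hypercenter)
  interpret h: group_hom G "G Mod hypercenter G" "\<lambda>x. hypercenter G #> x"
    by (rule Z.group_hom_FactGroup)
  have "iter_comm (G Mod hypercenter G) (hypercenter G #> x) 1 (hypercenter G #> x)
      = \<one>\<^bsub>G Mod hypercenter G\<^esub>"
    by (rule h.H.iter_comm_self) (use assms(1) in auto)
  then show ?thesis
    using engel_iff_engel_Mod_hypercenter[OF assms(1,2)] unfolding assms(3) by blast
qed

end

text \<open>The fibre over a coset \<open>q\<close> is \<open>q\<close> itself as a set, and all
  cosets have the size of \<open>H\<close>.\<close>

lemma (in group) card_fibre_rcos:
  assumes "subgroup H G" "q \<in> (\<lambda>x. H #> x) ` carrier G"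
  shows "card {x \<in> carrier G. H #> x = q} = card H"
proof -
  obtain y where y: "y \<in> carrier G" "q = H #> y"
    using assms(2) by blast
  have "{x \<in> carrier G. H #> x = q} = q"
    using y assms(1) repr_independence[of _ H y] rcos_self[of _ H] r_coset_subset_G[of H y]
      subgroup.subset[OF assms(1)] by blast
  moreover have "q \<in> rcosets H"
    using y by (auto simp: RCOSETS_def)
  ultimately show ?thesis
    using card_rcosets_equal[of q H] subgroup.subset[OF assms(1)] by simp
qed

section \<open>Blow-ups and lexicographic products\<close>

text \<open>Arcs are pairs of vertices, so \<open>f\<close> determines the arc map
  \<open>map_prod f f\<close>; it is injective on arcs since their endpoints are vertices, where
  \<open>f\<close> is injective.\<close>

lemma digraph_iso_with_projI:
  assumes "pair_wf_digraph D" and bij: "bij_betw f (pverts D) (pverts E)"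
    and "parcs E = map_prod f f ` parcs D"
  shows "digraph_iso (with_proj D) (with_proj E)"
proof -
  interpret pair_wf_digraph D by fact
  let ?h = "\<lparr>iso_verts = f, iso_arcs = map_prod f f, iso_head = snd, iso_tail = fst\<rparr>"
  have "parcs D \<subseteq> pverts D \<times> pverts D"
    using wellformed' by auto
  moreover have "inj_on (map_prod f f) (pverts D \<times> pverts D)"
    using bij by (intro map_prod_inj_on) (auto simp: bij_betw_def)
  ultimately have "inj_on (map_prod f f) (parcs D)"
    by (rule inj_on_subset[rotated])
  then have "pre_digraph.digraph_isomorphism (with_proj D) ?h"
    using bij wf_digraph_axioms by (auto simp: pre_digraph.digraph_isomorphism_def bij_betw_def)
  moreover have "with_proj E = app_iso ?h (with_proj D)"
    using bij assms(3) by (simp add: app_iso_def with_proj_def bij_betw_def)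
  ultimately show ?thesis
    unfolding digraph_iso_def by blast
qed

text \<open>The last assumption makes \<open>D1\<close> and all fibres of \<open>p\<close> simultaneously complete or
  simultaneously null, so any bijections between them are isomorphisms.\<close>

lemma digraph_iso_lex_product:
  assumes wf: "pair_wf_digraph D"
    and p: "p ` pverts D = pverts D2"
    and fin: "finite (pverts D1)" "finite (pverts D)"
    and card: "\<And>q. q \<in> pverts D2 \<Longrightarrow> card {x \<in> pverts D. p x = q} = card (pverts D1)"
    and between: "\<And>x y. x \<in> pverts D \<Longrightarrow> y \<in> pverts D \<Longrightarrow> p x \<noteq> p y \<Longrightarrow>
      (x, y) \<in> parcs D \<longleftrightarrow> (p x, p y) \<in> parcs D2"
    and inside: "\<And>x y a b. x \<in> pverts D \<Longrightarrow> y \<in> pverts D \<Longrightarrow> p x = p y \<Longrightarrow>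
      a \<in> pverts D1 \<Longrightarrow> b \<in> pverts D1 \<Longrightarrow> x = y \<longleftrightarrow> a = b \<Longrightarrow>
      (x, y) \<in> parcs D \<longleftrightarrow> (a, b) \<in> parcs D1"
  shows "digraph_iso (with_proj D) (with_proj (lex_product D1 D2))"
proof -
  interpret pair_wf_digraph D by fact
  have "\<exists>f. bij_betw f {x \<in> pverts D. p x = q} (pverts D1)" if "q \<in> pverts D2" for q
    using fin card[OF that] by (intro finite_same_card_bij) auto
  then obtain f where f: "bij_betw (f q) {x \<in> pverts D. p x = q} (pverts D1)"
    if "q \<in> pverts D2" for q
    by metis
  \<comment> \<open>The first coordinate is the position of \<open>x\<close> within its fibre, the
    second names the fibre.\<close>
  define F where "F x = (f (p x) x, p x)" for x
  have f_mem: "f (p x) x \<in> pverts D1" if "x \<in> pverts D" for x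
    using that p f[of "p x"] by (auto simp: bij_betw_def)
  have f_eq: "f (p x) x = f (p x) y \<longleftrightarrow> x = y"
    if "x \<in> pverts D" "y \<in> pverts D" "p x = p y" for x y
    using that p f[of "p x"] by (auto simp: bij_betw_def dest: inj_onD)
  have bij: "bij_betw F (pverts D) (pverts D1 \<times> pverts D2)"
    unfolding bij_betw_def
  proof
    show "inj_on F (pverts D)"
      using f_eq by (auto simp: F_def inj_on_def)
    show "F ` pverts D = pverts D1 \<times> pverts D2"
    proof
      show "F ` pverts D \<subseteq> pverts D1 \<times> pverts D2"
        using f_mem p by (auto simp: F_def)
      show "pverts D1 \<times> pverts D2 \<subseteq> F ` pverts D"
      proof clarify
        fix a q assume "a \<in> pverts D1" and q: "q \<in> pverts D2"
        then have "a \<in> f q ` {x \<in> pverts D. p x = q}"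
          using f[OF q] by (simp add: bij_betw_def)
        then show "(a, q) \<in> F ` pverts D"
          by (auto simp: F_def)
      qed
    qed
  qed
  have arcs: "(F x, F y) \<in> parcs (lex_product D1 D2) \<longleftrightarrow> (x, y) \<in> parcs D"
    if "x \<in> pverts D" "y \<in> pverts D" for x y
  proof (cases "p x = p y")
    case True
    \<comment> \<open>Injectivity of \<open>f\<close> on the common fibre gives the matching of
      equalities that \<open>inside\<close> requires.\<close>
    have "(x, y) \<in> parcs D \<longleftrightarrow> (f (p x) x, f (p y) y) \<in> parcs D1"
      using that True f_eq[of x y] f_mem[of x] f_mem[of y] by (intro inside) simp_all
    then show ?thesis
      using that True p f_mem[of x] f_mem[of y] by (auto simp: lex_product_def F_def)
  next
    case False
    then show ?thesis
      using that p f_mem between[of x y] by (auto simp: lex_product_def F_def)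
  qed
  have "parcs (lex_product D1 D2) = map_prod F F ` parcs D"
  proof
    show "map_prod F F ` parcs D \<subseteq> parcs (lex_product D1 D2)"
      using arcs wellformed' by auto
    show "parcs (lex_product D1 D2) \<subseteq> map_prod F F ` parcs D"
    proof clarify
      fix a q b r assume *: "((a, q), (b, r)) \<in> parcs (lex_product D1 D2)"
      then have "(a, q) \<in> F ` pverts D" "(b, r) \<in> F ` pverts D"
        using bij by (auto simp: lex_product_def bij_betw_def)
      then obtain x y where "x \<in> pverts D" "y \<in> pverts D" "(a, q) = F x" "(b, r) = F y"
        by blast
      with * arcs show "((a, q), (b, r)) \<in> map_prod F F ` parcs D"
        by (metis map_prod_imageI)
    qed
  qed
  with wf bij show ?thesis
    by (intro digraph_iso_with_projI) (auto simp: lex_product_def)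
qed

lemma null_digraphD:
  assumes "null_digraph n (with_proj D)"
  shows "finite (pverts D)" "card (pverts D) = n" "parcs D = {}"
proof -
  interpret graph "with_proj D"
    using assms by (simp add: null_digraph_def)
  show "finite (pverts D)" "card (pverts D) = n" "parcs D = {}"
    using assms finite_verts by (simp_all add: null_digraph_def)
qed

section \<open>Engel graphs\<close>

lemma pverts_engel_digraph [simp]: "pverts (engel_digraph G) = carrier G"
  by (simp add: engel_digraph_def)

lemma parcs_engel_digraph:
  "(x, y) \<in> parcs (engel_digraph G) \<longleftrightarrow> x \<in> carrier G \<and> y \<in> carrier G \<and> x \<noteq> y \<and>
    (\<exists>k \<ge> 1. iter_comm G y k x = \<one>\<^bsub>G\<^esub>)"
  by (simp add: engel_digraph_def)

lemma pverts_coengel_graph [simp]: "pverts (coengel_graph G) = carrier G"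
  by (simp add: coengel_graph_def complement_graph_def pverts_engel_graph)

lemma parcs_coengel_graph:
  "(x, y) \<in> parcs (coengel_graph G) \<longleftrightarrow> x \<in> carrier G \<and> y \<in> carrier G \<and> x \<noteq> y \<and>
    (x, y) \<notin> parcs (engel_graph G)"
  by (simp add: coengel_graph_def complement_graph_def pverts_engel_graph)

lemma pair_wf_digraph_engel:
  "pair_wf_digraph (engel_digraph G)"
  "pair_wf_digraph (engel_graph G)"
  "pair_wf_digraph (coengel_graph G)"
  by (unfold_locales;
    auto simp: parcs_engel_digraph parcs_engel_graph parcs_coengel_graph pverts_engel_graph)+

text \<open>\<open>K\<close> and \<open>N\<close> stand for any complete and any null digraph of the
  given order, on arbitrary vertex types, rather than for fixed models.\<close>

theorem theorem3p4:
  fixes G :: "('a, 'b) monoid_scheme"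
    and K :: "'k pair_pre_digraph" and N :: "'n pair_pre_digraph"
  assumes "group G" and "finite (carrier G)"
    and "complete_digraph (card (hypercenter G)) (with_proj K)"
    and "null_digraph (card (hypercenter G)) (with_proj N)"
  shows "digraph_iso (with_proj (engel_digraph G))
           (with_proj (lex_product K (engel_digraph (G Mod hypercenter G)))) \<and>
         digraph_iso (with_proj (engel_graph G))
           (with_proj (lex_product K (engel_graph (G Mod hypercenter G)))) \<and>
         digraph_iso (with_proj (coengel_graph G))
           (with_proj (lex_product N (coengel_graph (G Mod hypercenter G))))"
proof -
  interpret group G by fact
  let ?Z = "hypercenter G"
  let ?p = "\<lambda>x. ?Z #>\<^bsub>G\<^esub> x"
  have K: "finite (pverts K)" "card (pverts K) = card ?Z"
      "parcs K = {(a, b). (a, b) \<in> pverts K \<times> pverts K \<and> a \<noteq> b}"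
    using assms(3) by (simp_all add: complete_digraph_pair_def)
  note N = null_digraphD[OF assms(4)]
  note fibre = card_fibre_rcos[OF normal_imp_subgroup[OF normal_hypercenter]]
  note quot = engel_iff_engel_Mod_hypercenter
  note same = engel_if_rcos_hypercenter_eq
  \<comment> \<open>Adjacency is a disjunction of Engel conditions in both orders, so
    \<open>quot\<close> is used in both. The equivalence serves the Engel graph and, negated, its
    complement.\<close>
  have between_engel_graph: "(x, y) \<in> parcs (engel_graph G) \<longleftrightarrow>
      (?p x, ?p y) \<in> parcs (engel_graph (G Mod ?Z))"
    if "x \<in> carrier G" "y \<in> carrier G" "?p x \<noteq> ?p y" for x y
  proof -
    have "x \<noteq> y" using that(3) by blast
    moreover have "?p x \<in> carrier (G Mod ?Z)" "?p y \<in> carrier (G Mod ?Z)"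
      using that by (simp_all add: carrier_FactGroup)
    ultimately show ?thesis
      using that quot[of x y] quot[of y x] unfolding parcs_engel_graph by blast
  qed
  have fin: "finite (carrier G)" by fact
  have digraph: "digraph_iso (with_proj (engel_digraph G))
      (with_proj (lex_product K (engel_digraph (G Mod ?Z))))"
  proof (rule digraph_iso_lex_product[where p = ?p])
    show "(x, y) \<in> parcs (engel_digraph G) \<longleftrightarrow> (?p x, ?p y) \<in> parcs (engel_digraph (G Mod ?Z))"
      if "x \<in> pverts (engel_digraph G)" "y \<in> pverts (engel_digraph G)" "?p x \<noteq> ?p y" for x y
      \<comment> \<open>The arguments are swapped because an arc from \<open>x\<close> to
        \<open>y\<close> iterates commutation of \<open>y\<close> with \<open>x\<close>.\<close>
      using that quot[of y x] by (auto simp: parcs_engel_digraph carrier_FactGroup)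
    show "(x, y) \<in> parcs (engel_digraph G) \<longleftrightarrow> (a, b) \<in> parcs K"
      if "x \<in> pverts (engel_digraph G)" "y \<in> pverts (engel_digraph G)" "?p x = ?p y"
        "a \<in> pverts K" "b \<in> pverts K" "x = y \<longleftrightarrow> a = b" for x y a b
      using that same[of y x] by (auto simp: parcs_engel_digraph K(3))
  qed (use fin K fibre in \<open>auto simp: pair_wf_digraph_engel carrier_FactGroup\<close>)
  have graph: "digraph_iso (with_proj (engel_graph G))
      (with_proj (lex_product K (engel_graph (G Mod ?Z))))"
  proof (rule digraph_iso_lex_product[where p = ?p])
    show "(x, y) \<in> parcs (engel_graph G) \<longleftrightarrow> (?p x, ?p y) \<in> parcs (engel_graph (G Mod ?Z))"
      if "x \<in> pverts (engel_graph G)" "y \<in> pverts (engel_graph G)" "?p x \<noteq> ?p y" for x y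
      using that between_engel_graph by (simp add: pverts_engel_graph)
    show "(x, y) \<in> parcs (engel_graph G) \<longleftrightarrow> (a, b) \<in> parcs K"
      if "x \<in> pverts (engel_graph G)" "y \<in> pverts (engel_graph G)" "?p x = ?p y"
        "a \<in> pverts K" "b \<in> pverts K" "x = y \<longleftrightarrow> a = b" for x y a b
      using that same[of y x] unfolding parcs_engel_graph K(3) pverts_engel_graph by blast
  qed (use fin K fibre in \<open>auto simp: pair_wf_digraph_engel pverts_engel_graph carrier_FactGroup\<close>)
  have cograph: "digraph_iso (with_proj (coengel_graph G))
      (with_proj (lex_product N (coengel_graph (G Mod ?Z))))"
  proof (rule digraph_iso_lex_product[where p = ?p])
    show "(x, y) \<in> parcs (coengel_graph G) \<longleftrightarrow> (?p x, ?p y) \<in> parcs (coengel_graph (G Mod ?Z))"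
      if "x \<in> pverts (coengel_graph G)" "y \<in> pverts (coengel_graph G)" "?p x \<noteq> ?p y" for x y
      using that between_engel_graph[of x y]
      by (auto simp: parcs_coengel_graph carrier_FactGroup)
    show "(x, y) \<in> parcs (coengel_graph G) \<longleftrightarrow> (a, b) \<in> parcs N"
      if "x \<in> pverts (coengel_graph G)" "y \<in> pverts (coengel_graph G)" "?p x = ?p y"
        "a \<in> pverts N" "b \<in> pverts N" "x = y \<longleftrightarrow> a = b" for x y a b
    proof -
      \<comment> \<open>Distinct elements of one coset are Engel-adjacent, so the complement has no
        arc inside a coset, just as \<open>N\<close> has none.\<close>
      have "(x, y) \<notin> parcs (coengel_graph G)"
        using that(1-3) same[of y x] unfolding parcs_coengel_graph parcs_engel_graph pverts_coengel_graph
        by blast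
      then show ?thesis by (simp add: N(3))
    qed
  qed (use fin N fibre in \<open>auto simp: pair_wf_digraph_engel carrier_FactGroup\<close>)
  show ?thesis
    using digraph graph cograph by blast
qed

end
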